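(* For a commutative monoid $A$, let $\mathcal{F}(A)=\mathcal{P}_f(A)$ be the set of finite subsets of $A$, with multiplication $B\cdot C=\{xy : x\in B,\ y\in C\}$ for $B,C\in\mathcal{F}(A)$. Then $\mathcal{F}(A)$, with the $B_1$-module structure associated with its order by inclusion (addition $\cup$, zero element $\emptyset$) and this multiplication, is a $B_1$-algebra. One has $\mathcal{F}(F_1)=B_1$, where $F_1=\{1\}$ is the trivial monoid (here $\emptyset$ corresponds to $0$ and $\{1\}$ to $1$). Moreover, if $A_1$ and $A_2$ are commutative monoids and $\varphi:A_1\to A_2$ is a morphism of monoids, then the map $\mathcal{F}(\varphi):\mathcal{F}(A_1)\to\mathcal{F}(A_2)$ defined by $\mathcal{F}(\varphi)(B)=\{\varphi(b): b\in B\}$ for all $B\in\mathcal{F}(A_1)$ is a morphism of $B_1$-algebras, and $\mathcal{F}$ defines a covariant functor from the category $\mathcal{D}$ of commutative monoids to the category $\mathcal{Z}_a$ of $B_1$-algebras.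
   Context: $B_1=\{0,1\}$ with addition $0+0=0$, $0+1=1+0=1+1=1$ and the usual multiplication. Monoids are unital, and morphisms of monoids preserve the unit. A $B_1$-module is a commutative monoid $(M,+)$ with neutral element $0$ and an external law $B_1\times M\to M$ satisfying $(\lambda+\mu)x=\lambda x+\mu x$, $\lambda(x+y)=\lambda x+\lambda y$, $1x=x$, $0x=0$. An ordered set with least element $0$ in which any two elements have a least upper bound is a $B_1$-module via $a+b=a\vee b$, $0a=0$, $1a=a$. A (commutative, unital) $B_1$-algebra is a $B_1$-module $\mathcal{A}$ containing $B_1$ (so $0\neq 1$) with an associative, commutative multiplication with neutral element $1$, bilinear for the $B_1$-module operations (in particular $0\cdot a=0$); morphisms preserve $+,\cdot,0,1$. *)

theory Defs
  imports "HOL-Algebra.Coset" "HOL-Algebra.Module"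
begin

section \<open>The semifield B1, its modules and its algebras\<close>

text \<open>One record serves both as the ring of scalars and as an algebra over itself.\<close>

definition B1 :: "(nat, nat) module" where
  "B1 = \<lparr>carrier = {0, 1}, mult = (*), one = 1, zero = 0,
         add = (\<lambda>x y. if x = 0 \<and> y = 0 then 0 else 1), smult = (*)\<rparr>"

locale B1_module = abelian_monoid M
  for M :: "(nat, 'a, 'm) module_scheme" (structure) +
  assumes smult_closed: "\<lbrakk>c \<in> carrier B1; x \<in> carrier M\<rbrakk> \<Longrightarrow> c \<odot> x \<in> carrier M"
    and smult_l_distr: "\<lbrakk>c \<in> carrier B1; d \<in> carrier B1; x \<in> carrier M\<rbrakk>
      \<Longrightarrow> (c \<oplus>\<^bsub>B1\<^esub> d) \<odot> x = (c \<odot> x) \<oplus> (d \<odot> x)"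
    and smult_r_distr: "\<lbrakk>c \<in> carrier B1; x \<in> carrier M; y \<in> carrier M\<rbrakk>
      \<Longrightarrow> c \<odot> (x \<oplus> y) = (c \<odot> x) \<oplus> (c \<odot> y)"
    and smult_one: "x \<in> carrier M \<Longrightarrow> \<one>\<^bsub>B1\<^esub> \<odot> x = x"
    and smult_zero: "x \<in> carrier M \<Longrightarrow> \<zero>\<^bsub>B1\<^esub> \<odot> x = \<zero>"

text \<open>The algebra contains B1 through \<open>c \<mapsto> c \<odot> \<one>\<close>, that is, through
  \<open>0 \<mapsto> \<zero>\<close> and \<open>1 \<mapsto> \<one>\<close>; injectivity of this map amounts to \<open>\<zero> \<noteq> \<one>\<close>.\<close>

locale B1_algebra = B1_module M + comm_monoid M
  for M :: "(nat, 'a, 'm) module_scheme" (structure) +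
  assumes contains_B1: "inj_on (\<lambda>c. c \<odot> \<one>) (carrier B1)"
    and mult_add_l: "\<lbrakk>x \<in> carrier M; y \<in> carrier M; z \<in> carrier M\<rbrakk>
      \<Longrightarrow> (x \<oplus> y) \<otimes> z = (x \<otimes> z) \<oplus> (y \<otimes> z)"
    and mult_add_r: "\<lbrakk>x \<in> carrier M; y \<in> carrier M; z \<in> carrier M\<rbrakk>
      \<Longrightarrow> z \<otimes> (x \<oplus> y) = (z \<otimes> x) \<oplus> (z \<otimes> y)"
    and mult_smult_l: "\<lbrakk>c \<in> carrier B1; x \<in> carrier M; y \<in> carrier M\<rbrakk>
      \<Longrightarrow> (c \<odot> x) \<otimes> y = c \<odot> (x \<otimes> y)"
    and mult_smult_r: "\<lbrakk>c \<in> carrier B1; x \<in> carrier M; y \<in> carrier M\<rbrakk>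
      \<Longrightarrow> x \<otimes> (c \<odot> y) = c \<odot> (x \<otimes> y)"

lemma B1_algebra_B1: "B1_algebra B1"
  by unfold_locales (auto simp: B1_def)

text \<open>The library's \<^const>\<open>ring_hom\<close> does not ask for preservation of zero, which is not
  automatic in the absence of additive inverses.\<close>

definition B1_algebra_hom ::
    "(nat, 'a, 'm) module_scheme \<Rightarrow> (nat, 'b, 'n) module_scheme \<Rightarrow> ('a \<Rightarrow> 'b) set" where
  "B1_algebra_hom M N = {f \<in> ring_hom M N. f \<zero>\<^bsub>M\<^esub> = \<zero>\<^bsub>N\<^esub>}"

definition B1_algebra_iso ::
    "(nat, 'a, 'm) module_scheme \<Rightarrow> (nat, 'b, 'n) module_scheme \<Rightarrow> ('a \<Rightarrow> 'b) set" where
  "B1_algebra_iso M N = {f \<in> B1_algebra_hom M N. bij_betw f (carrier M) (carrier N)}"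

text \<open>\<open>M\<close> carries the B1-module structure associated with the order \<open>L\<close>, which has a least
  element and binary least upper bounds.\<close>

definition order_B1_structure :: "'a gorder \<Rightarrow> (nat, 'a, 'm) module_scheme \<Rightarrow> bool" where
  "order_B1_structure L M \<longleftrightarrow>
     upper_semilattice L \<and> carrier M = carrier L \<and>
     least L \<zero>\<^bsub>M\<^esub> (carrier L) \<and>
     (\<forall>x\<in>carrier L. \<forall>y\<in>carrier L. least L (x \<oplus>\<^bsub>M\<^esub> y) (Upper L {x, y})) \<and>
     (\<forall>x\<in>carrier L. \<zero>\<^bsub>B1\<^esub> \<odot>\<^bsub>M\<^esub> x = \<zero>\<^bsub>M\<^esub> \<and> \<one>\<^bsub>B1\<^esub> \<odot>\<^bsub>M\<^esub> x = x)"


section \<open>Monoids and their finite subsets\<close>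

text \<open>The library's \<^const>\<open>hom\<close> does not ask for preservation of the unit.\<close>

definition unital_hom ::
    "('a, 'm) monoid_scheme \<Rightarrow> ('b, 'n) monoid_scheme \<Rightarrow> ('a \<Rightarrow> 'b) set" where
  "unital_hom A B = {f \<in> hom A B. f \<one>\<^bsub>A\<^esub> = \<one>\<^bsub>B\<^esub>}"

definition F1 :: "nat monoid" where
  "F1 = \<lparr>carrier = {1}, mult = (*), one = 1\<rparr>"

lemma comm_monoid_F1: "comm_monoid F1"
  by unfold_locales (auto simp: F1_def)

definition finsets :: "('a, 'm) monoid_scheme \<Rightarrow> (nat, 'a set) module" where
  "finsets A = \<lparr>carrier = Fpow (carrier A), mult = set_mult A, one = {\<one>\<^bsub>A\<^esub>}, zero = {},
                add = (\<union>), smult = (\<lambda>c B. if c = 0 then {} else B)\<rparr>"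

definition finsets_order :: "('a, 'm) monoid_scheme \<Rightarrow> 'a set gorder" where
  "finsets_order A = \<lparr>carrier = Fpow (carrier A), eq = (=), le = (\<subseteq>)\<rparr>"

definition finsets_map :: "('a, 'm) monoid_scheme \<Rightarrow> ('a \<Rightarrow> 'b) \<Rightarrow> 'a set \<Rightarrow> 'b set" where
  "finsets_map A \<phi> = (\<lambda>B\<in>carrier (finsets A). \<phi> ` B)"


section \<open>Categories and functors\<close>

text \<open>\<open>Comp C X Y Z g f\<close> is the composite of \<open>f : X \<rightarrow> Y\<close> followed by \<open>g : Y \<rightarrow> Z\<close>.\<close>

record ('o, 'm) cat_data =
  Obj :: "'o set"
  Hom :: "'o \<Rightarrow> 'o \<Rightarrow> 'm set"
  Ident :: "'o \<Rightarrow> 'm"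
  Comp :: "'o \<Rightarrow> 'o \<Rightarrow> 'o \<Rightarrow> 'm \<Rightarrow> 'm \<Rightarrow> 'm"

locale category =
  fixes C :: "('o, 'm) cat_data"
  assumes Ident_in: "X \<in> Obj C \<Longrightarrow> Ident C X \<in> Hom C X X"
    and Comp_in: "\<lbrakk>X \<in> Obj C; Y \<in> Obj C; Z \<in> Obj C; f \<in> Hom C X Y; g \<in> Hom C Y Z\<rbrakk>
      \<Longrightarrow> Comp C X Y Z g f \<in> Hom C X Z"
    and Comp_Ident_right: "\<lbrakk>X \<in> Obj C; Y \<in> Obj C; f \<in> Hom C X Y\<rbrakk>
      \<Longrightarrow> Comp C X X Y f (Ident C X) = f"
    and Comp_Ident_left: "\<lbrakk>X \<in> Obj C; Y \<in> Obj C; f \<in> Hom C X Y\<rbrakk>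
      \<Longrightarrow> Comp C X Y Y (Ident C Y) f = f"
    and Comp_assoc: "\<lbrakk>W \<in> Obj C; X \<in> Obj C; Y \<in> Obj C; Z \<in> Obj C;
        f \<in> Hom C W X; g \<in> Hom C X Y; h \<in> Hom C Y Z\<rbrakk>
      \<Longrightarrow> Comp C W X Z (Comp C X Y Z h g) f = Comp C W Y Z h (Comp C W X Y g f)"

locale covariant_functor = source: category C + target: category D
  for C :: "('o, 'm) cat_data" and D :: "('p, 'n) cat_data" +
  fixes obj_map :: "'o \<Rightarrow> 'p" and hom_map :: "'o \<Rightarrow> 'o \<Rightarrow> 'm \<Rightarrow> 'n"
  assumes obj_map_in: "X \<in> Obj C \<Longrightarrow> obj_map X \<in> Obj D"
    and hom_map_in: "\<lbrakk>X \<in> Obj C; Y \<in> Obj C; f \<in> Hom C X Y\<rbrakk>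
      \<Longrightarrow> hom_map X Y f \<in> Hom D (obj_map X) (obj_map Y)"
    and hom_map_Ident: "X \<in> Obj C \<Longrightarrow> hom_map X X (Ident C X) = Ident D (obj_map X)"
    and hom_map_Comp: "\<lbrakk>X \<in> Obj C; Y \<in> Obj C; Z \<in> Obj C; f \<in> Hom C X Y; g \<in> Hom C Y Z\<rbrakk>
      \<Longrightarrow> hom_map X Z (Comp C X Y Z g f)
        = Comp D (obj_map X) (obj_map Y) (obj_map Z) (hom_map Y Z g) (hom_map X Y f)"

text \<open>A HOL type plays the role of the universe: the objects are the structures whose carrier is
  a set of elements of that type. Morphisms are taken extensional, so that equality of morphisms
  is equality on the carrier of the source.\<close>

definition comm_monoid_cat :: "('a monoid, 'a \<Rightarrow> 'a) cat_data" where
  "comm_monoid_cat = \<lparr>Obj = {A. comm_monoid A},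
     Hom = (\<lambda>A B. unital_hom A B \<inter> extensional (carrier A)),
     Ident = (\<lambda>A. \<lambda>x\<in>carrier A. x),
     Comp = (\<lambda>A B C g f. compose (carrier A) g f)\<rparr>"

definition B1_algebra_cat :: "((nat, 'a) module, 'a \<Rightarrow> 'a) cat_data" where
  "B1_algebra_cat = \<lparr>Obj = {M. B1_algebra M},
     Hom = (\<lambda>M N. B1_algebra_hom M N \<inter> extensional (carrier M)),
     Ident = (\<lambda>M. \<lambda>x\<in>carrier M. x),
     Comp = (\<lambda>M N P g f. compose (carrier M) g f)\<rparr>"

end

theory Submission
  imports Defs
begin

text \<open>A product of finite subsets is the union of the singletons
  \<open>{x \<otimes> y}\<close>. Associativity, commutativity and the unit law for subsets
  therefore come elementwise from the monoid, while bilinearity over union holds because a union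
  indexed by \<open>B \<union> C\<close> splits. This gives \<open>B1_algebra_finsets\<close>; the
  order is inclusion, whose joins are unions (\<open>order_B1_structure_finsets\<close>). Direct
  image commutes with unions always and with products when the map is multiplicative
  (\<open>set_mult_image\<close>), so monoid morphisms induce algebra morphisms
  (\<open>finsets_map_in_hom\<close>). Functoriality is that of direct image; the only care required
  is that all maps are extensional, so each argument must be shown to lie in the relevant carrier
  before a restricted map can be evaluated (\<open>finsets_map_id\<close>,
  \<open>finsets_map_compose\<close>).\<close>

lemma finsets_simps [simp]:
  "carrier (finsets A) = Fpow (carrier A)"
  "\<one>\<^bsub>finsets A\<^esub> = {\<one>\<^bsub>A\<^esub>}"
  "\<zero>\<^bsub>finsets A\<^esub> = {}"
  "B \<otimes>\<^bsub>finsets A\<^esub> C = B <#>\<^bsub>A\<^esub> C"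
  "B \<oplus>\<^bsub>finsets A\<^esub> C = B \<union> C"
  "c \<odot>\<^bsub>finsets A\<^esub> B = (if c = 0 then {} else B)"
  by (simp_all add: finsets_def)

lemma B1_simps [simp]:
  "carrier B1 = {0, 1}"
  "\<one>\<^bsub>B1\<^esub> = 1"
  "\<zero>\<^bsub>B1\<^esub> = 0"
  "x \<otimes>\<^bsub>B1\<^esub> y = x * y"
  "x \<oplus>\<^bsub>B1\<^esub> y = (if x = 0 \<and> y = 0 then 0 else 1)"
  "c \<odot>\<^bsub>B1\<^esub> x = c * x"
  by (simp_all add: B1_def)

lemma finsets_order_simps [simp]:
  "carrier (finsets_order A) = Fpow (carrier A)"
  "(.=\<^bsub>finsets_order A\<^esub>) = (=)"
  "(B \<sqsubseteq>\<^bsub>finsets_order A\<^esub> C) = (B \<subseteq> C)"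
  by (simp_all add: finsets_order_def)

lemma F1_simps [simp]:
  "carrier F1 = {1}"
  "\<one>\<^bsub>F1\<^esub> = 1"
  "x \<otimes>\<^bsub>F1\<^esub> y = x * y"
  by (simp_all add: F1_def)

lemma (in monoid) set_mult_in_Fpow:
  assumes "B \<in> Fpow (carrier G)" "C \<in> Fpow (carrier G)"
  shows "B <#> C \<in> Fpow (carrier G)"
  using assms by (auto simp: Fpow_def set_mult_def)

text \<open>Both sides flatten to a union of singletons over triples from \<open>B\<close>,
  \<open>C\<close> and \<open>D\<close>. The congruence rule makes membership in these sets
  available under the unions, so that \<open>m_assoc\<close> applies.\<close>

lemma (in monoid) set_mult_assoc_carrier:
  assumes "B \<subseteq> carrier G" "C \<subseteq> carrier G" "D \<subseteq> carrier G"
  shows "B <#> C <#> D = B <#> (C <#> D)"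
  unfolding set_mult_def
  by simp (use assms in \<open>simp add: subset_iff m_assoc cong: SUP_cong_simp\<close>)

lemma (in comm_monoid) set_mult_comm_carrier:
  assumes "B \<subseteq> carrier G" "C \<subseteq> carrier G"
  shows "B <#> C = C <#> B"
  unfolding set_mult_def
  by (subst SUP_commute) (use assms in \<open>simp add: m_comm subset_iff cong: SUP_cong_simp\<close>)

text \<open>Direct image distributes over the unions that define the product, leaving
  \<open>hom_mult\<close> on each singleton.\<close>

lemma set_mult_image:
  assumes "\<phi> \<in> hom A A'" "B \<subseteq> carrier A" "C \<subseteq> carrier A"
  shows "\<phi> ` (B <#>\<^bsub>A\<^esub> C) = \<phi> ` B <#>\<^bsub>A'\<^esub> \<phi> ` C"
  using assms by (simp add: set_mult_def image_UN hom_mult subset_iff cong: SUP_cong_simp)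

lemma partial_order_finsets_order: "partial_order (finsets_order A)"
  by unfold_locales auto

lemma least_Upper_finsets_order:
  assumes "B \<in> Fpow (carrier A)" "C \<in> Fpow (carrier A)"
  shows "least (finsets_order A) (B \<union> C) (Upper (finsets_order A) {B, C})"
  using assms by (auto simp: least_def Upper_def Fpow_def)

lemma upper_semilattice_finsets_order: "upper_semilattice (finsets_order A)"
proof -
  interpret partial_order "finsets_order A"
    by (rule partial_order_finsets_order)
  show ?thesis
    by unfold_locales (auto intro!: exI least_Upper_finsets_order)
qed

lemma order_B1_structure_finsets:
  "order_B1_structure (finsets_order A) (finsets A)"
  unfolding order_B1_structure_def
  by (auto simp: upper_semilattice_finsets_order least_Upper_finsets_order)
     (auto simp: least_def Fpow_def)

lemma B1_algebra_finsets:
  assumes "comm_monoid A"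
  shows "B1_algebra (finsets A)"
proof -
  interpret A: comm_monoid A by fact
  have comm_monoid: "comm_monoid (finsets A)"
  proof (rule comm_monoidI)
    fix B C D
    assume B: "B \<in> carrier (finsets A)" and C: "C \<in> carrier (finsets A)"
      and D: "D \<in> carrier (finsets A)"
    then show "B \<otimes>\<^bsub>finsets A\<^esub> C \<otimes>\<^bsub>finsets A\<^esub> D = B \<otimes>\<^bsub>finsets A\<^esub> (C \<otimes>\<^bsub>finsets A\<^esub> D)"
      by (simp add: A.set_mult_assoc_carrier Fpow_def)
  next
    fix B assume "B \<in> carrier (finsets A)"
    then show "\<one>\<^bsub>finsets A\<^esub> \<otimes>\<^bsub>finsets A\<^esub> B = B"
      by (auto simp: Fpow_def set_mult_def subset_iff)
  next
    fix B C
    assume "B \<in> carrier (finsets A)" "C \<in> carrier (finsets A)"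
    then show "B \<otimes>\<^bsub>finsets A\<^esub> C = C \<otimes>\<^bsub>finsets A\<^esub> B"
      by (simp add: A.set_mult_comm_carrier Fpow_def)
  qed (simp_all add: A.set_mult_in_Fpow, simp add: Fpow_def)
  have "abelian_monoid (finsets A)"
    by (rule abelian_monoidI) (auto simp: Fpow_def)
  \<comment> \<open>Distributivity is splitting of unions, compatibility with the scalar 0 says that
    a product with \<open>{}\<close> is empty, and \<open>contains_B1\<close> reduces to
    \<open>{}\<close> being different from the singleton of the unit.\<close>
  with comm_monoid show ?thesis
    by (intro B1_algebra.intro B1_module.intro B1_module_axioms.intro B1_algebra_axioms.intro)
       (auto simp: set_mult_def Fpow_def)
qed

lemma finsets_map_in_hom:
  assumes A: "monoid A" and \<phi>: "\<phi> \<in> unital_hom A A'"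
  shows "finsets_map A \<phi> \<in> B1_algebra_hom (finsets A) (finsets A')"
proof -
  have hom: "\<phi> \<in> hom A A'" and one: "\<phi> \<one>\<^bsub>A\<^esub> = \<one>\<^bsub>A'\<^esub>"
    using \<phi> by (auto simp: unital_hom_def)
  have im: "\<phi> ` B \<in> Fpow (carrier A')" if "B \<in> Fpow (carrier A)" for B
    using that hom by (auto simp: Fpow_def hom_def)
  have "finsets_map A \<phi> \<in> ring_hom (finsets A) (finsets A')"
  proof (rule ring_hom_memI)
    fix B C assume BC: "B \<in> carrier (finsets A)" "C \<in> carrier (finsets A)"
    \<comment> \<open>\<open>finsets_map\<close> is undefined outside \<open>Fpow\<close>, so it
      unfolds to an image at the product only once the product is known to lie there.\<close>
    then have "B <#>\<^bsub>A\<^esub> C \<in> Fpow (carrier A)"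
      by (simp add: monoid.set_mult_in_Fpow[OF A])
    with BC show "finsets_map A \<phi> (B \<otimes>\<^bsub>finsets A\<^esub> C)
        = finsets_map A \<phi> B \<otimes>\<^bsub>finsets A'\<^esub> finsets_map A \<phi> C"
      using set_mult_image[OF hom, of B C] by (simp add: finsets_map_def Fpow_def)
  next
    fix B C assume "B \<in> carrier (finsets A)" "C \<in> carrier (finsets A)"
    then show "finsets_map A \<phi> (B \<oplus>\<^bsub>finsets A\<^esub> C)
        = finsets_map A \<phi> B \<oplus>\<^bsub>finsets A'\<^esub> finsets_map A \<phi> C"
      by (simp add: finsets_map_def Fpow_def image_Un)
  qed (use im one monoid.one_closed[OF A] in \<open>simp_all add: finsets_map_def Fpow_def\<close>)
  then show ?thesis
    by (simp add: B1_algebra_hom_def finsets_map_def Fpow_def)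
qed

lemma finsets_map_id:
  "finsets_map A (\<lambda>x\<in>carrier A. x) = (\<lambda>B\<in>carrier (finsets A). B)"
  by (rule ext) (auto simp: finsets_map_def Fpow_def restrict_def image_iff subset_iff)

lemma finsets_map_compose:
  assumes "\<phi> \<in> unital_hom A A'"
  shows "finsets_map A (compose (carrier A) \<psi> \<phi>)
           = compose (carrier (finsets A)) (finsets_map A' \<psi>) (finsets_map A \<phi>)"
proof
  fix B
  \<comment> \<open>This lets the restricted map \<open>finsets_map A' \<psi>\<close> be evaluated
    at the image. For \<open>B\<close> outside \<open>Fpow\<close>, both sides are
    \<open>undefined\<close>.\<close>
  have "\<phi> ` B \<in> Fpow (carrier A')" if "B \<in> Fpow (carrier A)"
    using that assms by (auto simp: Fpow_def unital_hom_def hom_def)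
  moreover have "compose (carrier A) \<psi> \<phi> ` B = \<psi> ` \<phi> ` B" if "B \<in> Fpow (carrier A)"
    using that by (force simp: Fpow_def compose_def)
  ultimately show "finsets_map A (compose (carrier A) \<psi> \<phi>) B
      = compose (carrier (finsets A)) (finsets_map A' \<psi>) (finsets_map A \<phi>) B"
    by (simp add: finsets_map_def compose_def)
qed

lemma finsets_F1_iso_B1:
  "\<exists>h \<in> B1_algebra_iso (finsets F1) B1. h {} = 0 \<and> h {1} = 1"
proof -
  \<comment> \<open>Nonemptiness is multiplicative, and a union is nonempty iff one of its parts is,
    which matches 1 + 1 = 1 in \<open>B1\<close>.\<close>
  define h :: "nat set \<Rightarrow> nat" where "h B = (if B = {} then 0 else 1)" for B
  have carrier: "carrier (finsets F1) = {{}, {1}}"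
    by (auto simp: Fpow_def)
  have "h \<in> ring_hom (finsets F1) B1"
    by (rule ring_hom_memI) (auto simp: h_def Fpow_def set_mult_def)
  moreover have "bij_betw h (carrier (finsets F1)) (carrier B1)"
    unfolding carrier by (auto simp: bij_betw_def h_def)
  ultimately show ?thesis
    by (intro bexI[of _ h]) (auto simp: B1_algebra_iso_def B1_algebra_hom_def h_def)
qed

text \<open>Since \<open>compose\<close> is restricted to \<open>carrier A\<close>, closure of
  \<open>A\<close> under unit and product is what allows the composite to be evaluated
  there.\<close>

lemma unital_hom_compose:
  assumes "monoid A" "\<phi> \<in> unital_hom A B" "\<psi> \<in> unital_hom B C"
  shows "compose (carrier A) \<psi> \<phi> \<in> unital_hom A C"
proof -
  interpret A: monoid A by fact
  show ?thesis
    using assms(2,3) by (auto simp: unital_hom_def hom_def compose_def Pi_iff)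
qed

lemma (in B1_algebra) B1_algebra_hom_compose:
  assumes "f \<in> B1_algebra_hom M N" "g \<in> B1_algebra_hom N P"
  shows "compose (carrier M) g f \<in> B1_algebra_hom M P"
  using assms by (auto simp: B1_algebra_hom_def ring_hom_def compose_def Pi_iff)

lemma category_comm_monoid_cat: "category comm_monoid_cat"
proof
  fix A B C \<phi> \<psi>
  assume "A \<in> Obj comm_monoid_cat" "\<phi> \<in> Hom comm_monoid_cat A B" "\<psi> \<in> Hom comm_monoid_cat B C"
  then show "Comp comm_monoid_cat A B C \<psi> \<phi> \<in> Hom comm_monoid_cat A C"
    using unital_hom_compose[of A \<phi> B \<psi> C] by (simp add: comm_monoid_cat_def comm_monoid.axioms(1))
next
  fix A :: "'a monoid"
  assume "A \<in> Obj comm_monoid_cat"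
  then interpret comm_monoid A by (simp add: comm_monoid_cat_def)
  show "Ident comm_monoid_cat A \<in> Hom comm_monoid_cat A A"
    by (simp add: comm_monoid_cat_def unital_hom_def hom_def)
\<comment> \<open>The identity and associativity laws remain; extensionality turns agreement on the
  carrier into equality of functions.\<close>
qed (auto simp: comm_monoid_cat_def unital_hom_def hom_def compose_def fun_eq_iff Pi_iff extensional_def)

lemma category_B1_algebra_cat: "category B1_algebra_cat"
proof
  fix M N P f g
  assume "M \<in> Obj B1_algebra_cat" "f \<in> Hom B1_algebra_cat M N" "g \<in> Hom B1_algebra_cat N P"
  then show "Comp B1_algebra_cat M N P g f \<in> Hom B1_algebra_cat M P"
    using B1_algebra.B1_algebra_hom_compose[of M f N g P] by (simp add: B1_algebra_cat_def)
next
  fix M :: "(nat, 'a) module"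
  assume "M \<in> Obj B1_algebra_cat"
  then interpret B1_algebra M by (simp add: B1_algebra_cat_def)
  show "Ident B1_algebra_cat M \<in> Hom B1_algebra_cat M M"
    by (simp add: B1_algebra_cat_def B1_algebra_hom_def ring_hom_def)
qed (auto simp: B1_algebra_cat_def B1_algebra_hom_def ring_hom_def compose_def fun_eq_iff Pi_iff
       extensional_def)

lemma covariant_functor_finsets:
  "covariant_functor comm_monoid_cat B1_algebra_cat finsets (\<lambda>A B. finsets_map A)"
proof -
  interpret source: category comm_monoid_cat by (rule category_comm_monoid_cat)
  interpret target: category B1_algebra_cat by (rule category_B1_algebra_cat)
  show ?thesis
  proof
    fix A B \<phi>
    assume "A \<in> Obj comm_monoid_cat" "\<phi> \<in> Hom comm_monoid_cat A B"
    then show "finsets_map A \<phi> \<in> Hom B1_algebra_cat (finsets A) (finsets B)"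
      using finsets_map_in_hom[of A \<phi> B]
      by (simp add: comm_monoid_cat_def B1_algebra_cat_def finsets_map_def comm_monoid.axioms(1))
  next
    fix A B C \<phi> \<psi>
    assume "\<phi> \<in> Hom comm_monoid_cat A B"
    then show "finsets_map A (Comp comm_monoid_cat A B C \<psi> \<phi>)
      = Comp B1_algebra_cat (finsets A) (finsets B) (finsets C) (finsets_map B \<psi>) (finsets_map A \<phi>)"
      using finsets_map_compose[of \<phi> A B \<psi>]
      by (simp add: comm_monoid_cat_def B1_algebra_cat_def)
  \<comment> \<open>Objects and identities remain. Removing \<open>finsets_simps\<close> keeps
    \<open>carrier (finsets A)\<close> folded, as in \<open>finsets_map_id\<close>.\<close>
  qed (auto simp: comm_monoid_cat_def B1_algebra_cat_def B1_algebra_finsets finsets_map_id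
         simp del: finsets_simps)
qed

theorem mainTheorem6:
  shows "(\<forall>A :: 'a monoid. comm_monoid A \<longrightarrow>
            order_B1_structure (finsets_order A) (finsets A) \<and> B1_algebra (finsets A))
       \<and> (\<exists>h \<in> B1_algebra_iso (finsets F1) B1. h {} = 0 \<and> h {1} = 1)
       \<and> (\<forall>(A1 :: 'b monoid) (A2 :: 'c monoid) \<phi>.
            comm_monoid A1 \<and> comm_monoid A2 \<and> \<phi> \<in> unital_hom A1 A2 \<longrightarrow>
            finsets_map A1 \<phi> \<in> B1_algebra_hom (finsets A1) (finsets A2))
       \<and> (\<forall>A :: 'a monoid. comm_monoid A \<longrightarrow>
            finsets_map A (\<lambda>x\<in>carrier A. x) = (\<lambda>B\<in>carrier (finsets A). B))
       \<and> (\<forall>(A1 :: 'b monoid) (A2 :: 'c monoid) (A3 :: 'd monoid) \<phi> \<psi>.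
            comm_monoid A1 \<and> comm_monoid A2 \<and> comm_monoid A3 \<and>
            \<phi> \<in> unital_hom A1 A2 \<and> \<psi> \<in> unital_hom A2 A3 \<longrightarrow>
            finsets_map A1 (compose (carrier A1) \<psi> \<phi>)
              = compose (carrier (finsets A1)) (finsets_map A2 \<psi>) (finsets_map A1 \<phi>))
       \<and> covariant_functor
            (comm_monoid_cat :: ('u monoid, 'u \<Rightarrow> 'u) cat_data)
            (B1_algebra_cat :: ((nat, 'u set) module, 'u set \<Rightarrow> 'u set) cat_data)
            finsets (\<lambda>A B. finsets_map A)"
  by (intro conjI allI impI)
     (simp_all only: order_B1_structure_finsets B1_algebra_finsets finsets_F1_iso_B1
       finsets_map_in_hom comm_monoid.axioms(1) finsets_map_id finsets_map_compose covariant_functor_finsets)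

end
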